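(* For every graph $G$, the Seidel equivalence classes $[G]$ and $[\overline G]$ have the same number of elements (up to isomorphism), where $\overline G$ denotes the complement of $G$.
   Context: All graphs are finite, simple and undirected, with non-empty vertex set. For a graph $G$ and $S\subseteq V(G)$, the Seidel switch $S(G)$ is the graph on the same vertex set obtained by switching successively at each vertex of $S$ (in any order), where switching at a vertex $v$ complements the adjacency between $v$ and every other vertex and leaves all other adjacencies unchanged; by convention $\emptyset(G)=G$. Equivalently, $S(G)$ is obtained from $G$ by complementing all adjacencies between $S$ and $V(G)\setminus S$ and leaving the others unchanged. The Seidel equivalence class of $G$ is $[G]:=\{S(G): S\subseteq V(G)\}$, considered up to isomorphism; thus its number of elements is the number of isomorphism classes of graphs of the form $S(G)$, $S\subseteq V(G)$. *)

theory Defs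
  imports Main
begin

text \<open>A graph is a pair of a vertex set and a set of edges, each edge being a two-element set of
  vertices. All graphs of interest satisfy the predicate \<open>simple_graph\<close>.\<close>

type_synonym 'a ugraph = "'a set \<times> 'a set set"

abbreviation verts :: "'a ugraph \<Rightarrow> 'a set" where "verts G \<equiv> fst G"
abbreviation edges :: "'a ugraph \<Rightarrow> 'a set set" where "edges G \<equiv> snd G"

definition all_edges :: "'a set \<Rightarrow> 'a set set" where
  "all_edges V = {{u, v} | u v. u \<in> V \<and> v \<in> V \<and> u \<noteq> v}"

definition simple_graph :: "'a ugraph \<Rightarrow> bool" where
  "simple_graph G \<longleftrightarrow> finite (verts G) \<and> verts G \<noteq> {} \<and> edges G \<subseteq> all_edges (verts G)"

definition complement :: "'a ugraph \<Rightarrow> 'a ugraph" where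
  "complement G = (verts G, all_edges (verts G) - edges G)"

definition isomorphic :: "'a ugraph \<Rightarrow> 'a ugraph \<Rightarrow> bool" where
  "isomorphic G H \<longleftrightarrow> (\<exists>f. bij_betw f (verts G) (verts H) \<and>
     (\<forall>u\<in>verts G. \<forall>v\<in>verts G. {u, v} \<in> edges G \<longleftrightarrow> {f u, f v} \<in> edges H))"

definition switch_at :: "'a \<Rightarrow> 'a ugraph \<Rightarrow> 'a ugraph" where
  "switch_at v G =
     (let D = {{v, u} | u. u \<in> verts G \<and> u \<noteq> v}
      in (verts G, (edges G - D) \<union> (D - edges G)))"

text \<open>Switchings at single vertices commute, so folding \<open>switch_at\<close> over a finite set is
  independent of the order; \<open>seidel_switch_insert\<close> and \<open>adj_seidel_switch\<close> below
  confirm this and the equivalent description of the result.\<close>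

definition seidel_switch :: "'a set \<Rightarrow> 'a ugraph \<Rightarrow> 'a ugraph" where
  "seidel_switch S G = Finite_Set.fold switch_at G S"

definition seidel_class :: "'a ugraph \<Rightarrow> 'a ugraph set" where
  "seidel_class G = {seidel_switch S G | S. S \<subseteq> verts G}"

definition seidel_class_size :: "'a ugraph \<Rightarrow> nat" where
  "seidel_class_size G = card (seidel_class G // {(H, K). isomorphic H K})"

lemma verts_switch_at [simp]: "verts (switch_at v G) = verts G"
  by (simp add: switch_at_def Let_def)

lemma edges_switch_at:
  "e \<in> edges (switch_at v G) \<longleftrightarrow>
     (e \<in> edges G) \<noteq> (\<exists>u. u \<in> verts G \<and> u \<noteq> v \<and> e = {v, u})"
  by (auto simp: switch_at_def Let_def)

lemma comp_fun_commute_switch_at: "comp_fun_commute switch_at"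
proof
  fix u v :: 'a
  show "switch_at v \<circ> switch_at u = switch_at u \<circ> switch_at v"
  proof
    fix G :: "'a ugraph"
    show "(switch_at v \<circ> switch_at u) G = (switch_at u \<circ> switch_at v) G"
    proof (rule prod_eqI)
      show "edges ((switch_at v \<circ> switch_at u) G) = edges ((switch_at u \<circ> switch_at v) G)"
      proof (rule set_eqI)
        fix e
        define P Q where "P = (\<exists>w. w \<in> verts G \<and> w \<noteq> u \<and> e = {u, w})"
          and "Q = (\<exists>w. w \<in> verts G \<and> w \<noteq> v \<and> e = {v, w})"
        show "e \<in> edges ((switch_at v \<circ> switch_at u) G) \<longleftrightarrow>
              e \<in> edges ((switch_at u \<circ> switch_at v) G)"
          unfolding o_def edges_switch_at verts_switch_at P_def[symmetric] Q_def[symmetric]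
          by blast
      qed
    qed simp
  qed
qed

lemma seidel_switch_empty: "seidel_switch {} G = G"
  by (simp add: seidel_switch_def)

lemma seidel_switch_insert:
  fixes v :: 'a
  shows "finite S \<Longrightarrow> v \<notin> S \<Longrightarrow> seidel_switch (insert v S) G = switch_at v (seidel_switch S G)"
proof -
  interpret comp_fun_commute "switch_at :: 'a \<Rightarrow> _" by (rule comp_fun_commute_switch_at)
  assume "finite S" "v \<notin> S"
  then show "seidel_switch (insert v S) G = switch_at v (seidel_switch S G)"
    by (simp add: seidel_switch_def)
qed

lemma verts_seidel_switch: "finite S \<Longrightarrow> verts (seidel_switch S G) = verts G"
  by (induction rule: finite_induct) (simp_all add: seidel_switch_empty seidel_switch_insert)

lemma adj_seidel_switch:
  assumes "finite S" "x \<in> verts G" "y \<in> verts G" "x \<noteq> y"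
  shows "{x, y} \<in> edges (seidel_switch S G) \<longleftrightarrow>
           (if (x \<in> S) = (y \<in> S) then {x, y} \<in> edges G else {x, y} \<notin> edges G)"
  using assms(1)
proof (induction rule: finite_induct)
  case empty
  then show ?case by (simp add: seidel_switch_empty)
next
  case (insert v S)
  have "(\<exists>u. u \<in> verts G \<and> u \<noteq> v \<and> {x, y} = {v, u}) \<longleftrightarrow> x = v \<or> y = v"
    using assms by (auto simp: doubleton_eq_iff)
  then show ?case
    using insert assms(4)
    by (auto simp: seidel_switch_insert edges_switch_at verts_seidel_switch)
qed

lemma simple_graph_seidel_switch:
  assumes "simple_graph G" "S \<subseteq> verts G"
  shows "simple_graph (seidel_switch S G)"
proof -
  have "finite S" using assms by (auto simp: simple_graph_def intro: finite_subset)
  then show ?thesis using assms(2)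
  proof (induction rule: finite_induct)
    case empty
    then show ?case using assms(1) by (simp add: seidel_switch_empty)
  next
    case (insert v S)
    have "e \<in> all_edges (verts G)" if e: "e \<in> edges (seidel_switch (insert v S) G)" for e
    proof (cases "e \<in> edges (seidel_switch S G)")
      case True
      then show ?thesis
        using insert by (auto simp: simple_graph_def verts_seidel_switch)
    next
      case False
      then obtain u where "u \<in> verts G" "u \<noteq> v" "e = {v, u}"
        using e insert.hyps
        by (auto simp: seidel_switch_insert edges_switch_at verts_seidel_switch)
      then show ?thesis
        using insert.prems unfolding all_edges_def by blast
    qed
    then show ?case
      using assms(1) insert.hyps by (auto simp: simple_graph_def verts_seidel_switch)
  qed
qed

lemma simple_graph_complement: "simple_graph G \<Longrightarrow> simple_graph (complement G)"
  by (auto simp: simple_graph_def complement_def)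

lemma equiv_isomorphic: "equiv UNIV {(G, H). isomorphic (G :: 'a ugraph) H}"
proof (rule equivI)
  show "refl {(G, H). isomorphic (G :: 'a ugraph) H}"
    by (auto simp: refl_on_def isomorphic_def intro!: exI[of _ id])
  show "sym {(G, H). isomorphic (G :: 'a ugraph) H}"
  proof (rule symI, clarsimp)
    fix V W :: "'a set" and E F
    assume "isomorphic (V, E) (W, F)"
    then obtain f where f: "bij_betw f V W"
      "\<forall>u\<in>V. \<forall>v\<in>V. {u, v} \<in> E \<longleftrightarrow> {f u, f v} \<in> F"
      by (auto simp: isomorphic_def)
    have "bij_betw (inv_into V f) W V" using f(1) by (rule bij_betw_inv_into)
    moreover have "\<forall>u\<in>W. \<forall>v\<in>W. {u, v} \<in> F \<longleftrightarrow> {inv_into V f u, inv_into V f v} \<in> E"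
      using f(2) bij_betwE[OF bij_betw_inv_into[OF f(1)]]
      by (simp add: bij_betw_inv_into_right[OF f(1)])
    ultimately show "isomorphic (W, F) (V, E)" by (auto simp: isomorphic_def)
  qed
  show "trans {(G, H). isomorphic (G :: 'a ugraph) H}"
  proof (rule transI, clarify)
    fix V W X :: "'a set" and E F D
    assume "isomorphic (V, E) (W, F)" "isomorphic (W, F) (X, D)"
    then obtain f g where f: "bij_betw f V W"
      "\<forall>u\<in>V. \<forall>v\<in>V. {u, v} \<in> E \<longleftrightarrow> {f u, f v} \<in> F" and g: "bij_betw g W X"
      "\<forall>u\<in>W. \<forall>v\<in>W. {u, v} \<in> F \<longleftrightarrow> {g u, g v} \<in> D"
      by (auto simp: isomorphic_def)
    have "bij_betw (g \<circ> f) V X" using f(1) g(1) by (rule bij_betw_trans)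
    moreover have "\<forall>u\<in>V. \<forall>v\<in>V. {u, v} \<in> E \<longleftrightarrow> {(g \<circ> f) u, (g \<circ> f) v} \<in> D"
      using f g by (auto dest: bij_betwE)
    ultimately show "isomorphic (V, E) (X, D)"
      unfolding isomorphic_def fst_conv snd_conv by blast
  qed
qed simp

text \<open>The cardinality in \<open>seidel_class_size\<close> is that of a finite set.\<close>

lemma finite_seidel_class:
  assumes "simple_graph G"
  shows "finite (seidel_class G // {(H, K). isomorphic H K})"
proof -
  have "seidel_class G = (\<lambda>S. seidel_switch S G) ` Pow (verts G)"
    by (auto simp: seidel_class_def)
  then show ?thesis using assms by (auto simp: simple_graph_def quotient_def)
qed

end

theory Submission imports Defs begin

text \<open>Complementation and switching both act on the adjacency of each pair of vertices by negation
  or by the identity, independently of the graph, so they commute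
  (\<open>complement_seidel_switch\<close>). Hence complementation carries the switches of \<open>G\<close>
  exactly onto the switches of its complement (\<open>complement_image_seidel_class\<close>). Since
  complementation is an involution on simple graphs and a bijection preserving adjacency also
  preserves non-adjacency, two simple graphs are isomorphic iff their complements are
  (\<open>isomorphic_complement_iff\<close>). Complementation therefore induces a bijection between the
  isomorphism classes met by the two families.\<close>

lemma verts_complement [simp]: "verts (complement G) = verts G"
  by (simp add: complement_def)

lemma complement_complement: "simple_graph G \<Longrightarrow> complement (complement G) = G"
  by (auto simp: simple_graph_def complement_def prod_eq_iff)

lemma doubleton_in_edges_complement:
  assumes "u \<in> verts G" "v \<in> verts G"
  shows "{u, v} \<in> edges (complement G) \<longleftrightarrow> u \<noteq> v \<and> {u, v} \<notin> edges G"
proof -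
  have "{u, v} \<in> all_edges (verts G) \<longleftrightarrow> u \<noteq> v"
    using assms by (fastforce simp: all_edges_def doubleton_eq_iff)
  then show ?thesis by (simp add: complement_def)
qed

lemma isomorphic_complement:
  assumes "isomorphic G H"
  shows "isomorphic (complement G) (complement H)"
proof -
  obtain f where f: "bij_betw f (verts G) (verts H)"
    "\<forall>u\<in>verts G. \<forall>v\<in>verts G. {u, v} \<in> edges G \<longleftrightarrow> {f u, f v} \<in> edges H"
    using assms by (auto simp: isomorphic_def)
  have "{u, v} \<in> edges (complement G) \<longleftrightarrow> {f u, f v} \<in> edges (complement H)"
    if "u \<in> verts G" "v \<in> verts G" for u v
  proof -
    have "f u \<in> verts H" "f v \<in> verts H"
      using that bij_betwE[OF f(1)] by auto
    moreover have "f u = f v \<longleftrightarrow> u = v"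
      using that f(1) by (auto simp: bij_betw_def inj_on_eq_iff)
    ultimately show ?thesis
      using that f(2) by (simp add: doubleton_in_edges_complement)
  qed
  then show ?thesis using f(1) by (auto simp: isomorphic_def)
qed

lemma isomorphic_complement_iff:
  assumes "simple_graph G" "simple_graph H"
  shows "isomorphic (complement G) (complement H) \<longleftrightarrow> isomorphic G H"
  using isomorphic_complement[of G H] isomorphic_complement[of "complement G" "complement H"]
  by (auto simp: complement_complement assms)

text \<open>Switching replaces the edge set by its symmetric difference with the set \<open>D\<close> of pairs
  containing \<open>v\<close>, and complementation by its symmetric difference with the set of all pairs.
  The condition on \<open>v\<close> ensures that \<open>D\<close> consists of pairs of vertices.\<close>

lemma complement_switch_at:
  assumes "v \<in> verts G"
  shows "complement (switch_at v G) = switch_at v (complement G)"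
proof -
  define D where "D = {{v, u} | u. u \<in> verts G \<and> u \<noteq> v}"
  have "D \<subseteq> all_edges (verts G)"
    using assms unfolding D_def all_edges_def by blast
  then show ?thesis
    unfolding switch_at_def complement_def Let_def fst_conv snd_conv D_def[symmetric] by blast
qed

lemma complement_seidel_switch:
  assumes "finite S" "S \<subseteq> verts G"
  shows "complement (seidel_switch S G) = seidel_switch S (complement G)"
  using assms
  by (induction rule: finite_induct)
    (simp_all add: seidel_switch_empty seidel_switch_insert complement_switch_at verts_seidel_switch)

lemma complement_image_seidel_class:
  assumes "finite (verts G)"
  shows "complement ` seidel_class G = seidel_class (complement G)"
proof -
  have "seidel_class H = (\<lambda>S. seidel_switch S H) ` Pow (verts H)" for H :: "'a ugraph"
    by (auto simp: seidel_class_def)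
  then show ?thesis
    using assms
    by (auto simp: image_image complement_seidel_switch finite_subset intro!: image_cong)
qed

text \<open>The classes of \<open>A\<close> and of \<open>f ` A\<close> are matched by sending the class of \<open>x\<close> to
  that of \<open>f x\<close>; invariance under \<open>f\<close> makes this well defined, and reflection of the
  relation makes it injective.\<close>

lemma card_quotient_image:
  assumes r: "equiv UNIV r"
    and f: "\<And>x y. x \<in> A \<Longrightarrow> y \<in> A \<Longrightarrow> (f x, f y) \<in> r \<longleftrightarrow> (x, y) \<in> r"
  shows "card ((f ` A) // r) = card (A // r)"
proof -
  define h where "h X = r `` (f ` (X \<inter> A))" for X
  have class_eq: "r `` {x} = r `` {y} \<longleftrightarrow> (x, y) \<in> r" for x y
    using eq_equiv_class_iff[OF r] by simp
  have h: "h (r `` {x}) = r `` {f x}" if x: "x \<in> A" for x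
  proof -
    have "r `` {f y} = r `` {f x}" if "y \<in> r `` {x} \<inter> A" for y
      using that x f class_eq by blast
    moreover have "x \<in> r `` {x} \<inter> A"
      using x equiv_class_self[OF r] by simp
    ultimately show ?thesis unfolding h_def by blast
  qed
  have "inj_on h (A // r)"
  proof (rule inj_onI)
    fix X Y assume "X \<in> A // r" "Y \<in> A // r" and eq: "h X = h Y"
    then obtain x y where "x \<in> A" "y \<in> A" "X = r `` {x}" "Y = r `` {y}"
      by (meson quotientE)
    then show "X = Y" using eq by (simp add: h class_eq f)
  qed
  moreover have "h ` (A // r) = (f ` A) // r"
    using h by (auto simp: quotient_def)
  ultimately show ?thesis using card_image by metis
qed

theorem theorem3p3:
  fixes G :: "'a ugraph"
  assumes "simple_graph G"
  shows "seidel_class_size G = seidel_class_size (complement G)"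
proof -
  have "simple_graph H" if "H \<in> seidel_class G" for H
    using that simple_graph_seidel_switch[OF assms] by (auto simp: seidel_class_def)
  then have "card ((complement ` seidel_class G) // {(H, K). isomorphic H K})
      = card (seidel_class G // {(H, K). isomorphic H K})"
    by (intro card_quotient_image equiv_isomorphic) (simp add: isomorphic_complement_iff)
  then show ?thesis
    using assms
    by (simp add: seidel_class_size_def complement_image_seidel_class simple_graph_def)
qed

end
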